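(* Let $d\ge2$, $N\ge1$ and let $\rho$ be a state on $(\mathbb{C}^d)^{\otimes N}$. For operators $\lambda_1,\dots,\lambda_N$ on $\mathbb{C}^d$ define $$\mathcal{R}(\lambda_1,\dots,\lambda_N)=\int dU_1\cdots\int dU_N\;\Big|\mathrm{Tr}\Big(\rho\,\bigotimes_{n=1}^{N}U_n^\dagger\lambda_n^\dagger U_n\Big)\Big|^2,$$ where each integral is over $U(d)$ with respect to the normalized Haar measure. Then $\mathcal{R}(\lambda_1,\dots,\lambda_N)$ takes the same value for all choices of $\lambda_1,\dots,\lambda_N$ satisfying $\mathrm{Tr}(\lambda_n)=0$ and $\mathrm{Tr}(\lambda_n\lambda_n^\dagger)=d$ for every $n$. *)

theory Defs
  imports "HOL-Probability.Probability"
begin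

text \<open>Complex d x d matrices are represented as complex^'d^'d, with 'd a finite type, d = CARD('d).\<close>

definition cadj :: "complex^'d^'d \<Rightarrow> complex^'d^'d" where
  "cadj A = (\<chi> i j. cnj (A $ j $ i))"

definition unitary_mat :: "complex^'d^'d \<Rightarrow> bool" where
  "unitary_mat U \<longleftrightarrow> cadj U ** U = mat 1 \<and> U ** cadj U = mat 1"

text \<open>A normalized Haar measure on U(d): a Borel probability measure on the space of
  complex d x d matrices, concentrated on the unitary group and invariant under left
  multiplication by unitaries (on a compact group this determines it uniquely).\<close>

definition is_haar :: "(complex^'d^'d) measure \<Rightarrow> bool" where
  "is_haar M \<longleftrightarrow> prob_space M \<and> sets M = sets borel \<and>
     (AE U in M. unitary_mat U) \<and>
     (\<forall>V. unitary_mat V \<longrightarrow> distr M borel (\<lambda>U. V ** U) = M)"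

definition haar :: "(complex^'d^'d) measure" where
  "haar = (SOME M. is_haar M)"

text \<open>Kronecker (tensor) product of a family of d x d matrices indexed by the finite type 'n
  (N = CARD('n) tensor factors); the product space (C^d)^{\<otimes>N} is indexed by 'n \<Rightarrow> 'd.\<close>

definition tensor_prod :: "('n::finite \<Rightarrow> complex^'d^'d) \<Rightarrow> complex^('n \<Rightarrow> 'd)^('n \<Rightarrow> 'd)" where
  "tensor_prod A = (\<chi> i j. \<Prod>n\<in>UNIV. A n $ (i n) $ (j n))"

text \<open>Density matrices (states): positive semidefinite with unit trace.\<close>

definition is_state :: "complex^'m^'m \<Rightarrow> bool" where
  "is_state \<rho> \<longleftrightarrow> cadj \<rho> = \<rho> \<and>
     (\<forall>v::complex^'m. let q = (\<Sum>i\<in>UNIV. \<Sum>j\<in>UNIV. cnj (v $ i) * \<rho> $ i $ j * v $ j)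
                      in Im q = 0 \<and> Re q \<ge> 0) \<and>
     trace \<rho> = 1"

definition R_fun :: "complex^('n::finite \<Rightarrow> 'd)^('n \<Rightarrow> 'd) \<Rightarrow> ('n \<Rightarrow> complex^'d^'d) \<Rightarrow> real" where
  "R_fun \<rho> lam = (\<integral>Us. (cmod (trace (\<rho> ** tensor_prod (\<lambda>n. cadj (Us n) ** cadj (lam n) ** Us n))))\<^sup>2
                    \<partial>(PiM UNIV (\<lambda>_. haar)))"

end

theory Submission
  imports Defs
begin

text \<open>For a matrix \<open>X\<close> let \<open>K\<^sub>X(a,b,c,e) = \<integral> (U\<^sup>*XU)\<^sub>a\<^sub>b conj((U\<^sup>*XU)\<^sub>c\<^sub>e) dU\<close>.
  Expanding \<open>|Tr(\<rho> \<Otimes>\<^sub>n U\<^sub>n\<^sup>*\<lambda>\<^sub>n\<^sup>*U\<^sub>n)|\<^sup>2\<close> and integrating factorwise, \<open>R\<close> is a fixed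
  expression in \<open>\<rho>\<close> and the tensors \<open>K\<^bsub>\<lambda>\<^sub>n\<^sup>*\<^esub>\<close>. Right invariance of the Haar measure under
  permutation, diagonal phase and plane rotation matrices forces
  \<open>K\<^sub>X = \<alpha> \<delta>\<^sub>a\<^sub>b \<delta>\<^sub>c\<^sub>e + \<beta> \<delta>\<^sub>a\<^sub>c \<delta>\<^sub>b\<^sub>e\<close>, and the contractions
  \<open>\<Sum>\<^sub>a K\<^sub>X(a,a,c,c) = 0\<close> (from \<open>Tr X = 0\<close>) and \<open>\<Sum>\<^sub>a\<^sub>b K\<^sub>X(a,b,a,b) = Tr(XX\<^sup>*) = d\<close> give
  \<open>\<alpha> = 1/(1-d\<^sup>2)\<close>, \<open>\<beta> = -d/(1-d\<^sup>2)\<close>. So \<open>K\<close>, and with it \<open>R\<close>, is the same for all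
  admissible \<open>\<lambda>\<^sub>n\<close>.

  Since \<open>haar\<close> is defined by choice, a Haar measure has to be exhibited: the image of the
  uniform distribution on invertible matrices in a ball under the unitary factor of the QR
  decomposition. Gram--Schmidt commutes with left multiplication by unitaries, and those act
  on the real coordinates as orthogonal maps, which preserve Lebesgue measure.\<close>

section \<open>Unitary matrices\<close>

lemma cadj_nth [simp]: "cadj A $ i $ j = cnj (A $ j $ i)"
  by (simp add: cadj_def)

lemma cadj_cadj [simp]: "cadj (cadj A) = A"
  by (simp add: vec_eq_iff)

lemma cadj_mult: "cadj (A ** B) = cadj B ** cadj A"
  by (simp add: vec_eq_iff matrix_matrix_mult_def mult.commute)

lemma trace_cadj: "trace (cadj A) = cnj (trace A)"
  by (simp add: trace_def)

lemma unitary_mat_iff_left: "unitary_mat U \<longleftrightarrow> cadj U ** U = mat 1"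
  unfolding unitary_mat_def using matrix_left_right_inverse by blast

lemma unitary_mat_cadj: "unitary_mat U \<Longrightarrow> unitary_mat (cadj U)"
  by (simp add: unitary_mat_def)

lemma unitary_mat_mult: "unitary_mat U \<Longrightarrow> unitary_mat V \<Longrightarrow> unitary_mat (U ** V)"
  unfolding unitary_mat_iff_left cadj_mult
  by (metis matrix_mul_assoc matrix_mul_lid)

lemma det_unitary_nonzero: "unitary_mat U \<Longrightarrow> det U \<noteq> 0"
  unfolding unitary_mat_iff_left by (metis det_I det_mul mult_zero_right zero_neq_one)

lemma continuous_on_matrix_mult [continuous_intros]:
  fixes f :: "'a::topological_space \<Rightarrow> 'b::real_normed_algebra_1^'m::finite^'n"
  assumes "continuous_on S f" "continuous_on S g"
  shows "continuous_on S (\<lambda>x. f x ** g x)"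
  unfolding matrix_matrix_mult_def
  by (intro continuous_on_vec_lambda continuous_intros continuous_on_component assms)

lemma continuous_on_cadj [continuous_intros]:
  "continuous_on S f \<Longrightarrow> continuous_on S (\<lambda>x. cadj (f x))"
  unfolding cadj_def
  by (intro continuous_on_vec_lambda continuous_intros continuous_on_component)

lemma continuous_on_det [continuous_intros]:
  fixes f :: "'a::topological_space \<Rightarrow> 'b::{real_normed_algebra, comm_ring_1}^'d::finite^'d"
  assumes "continuous_on S f"
  shows "continuous_on S (\<lambda>x. det (f x))"
  unfolding det_def
  by (intro continuous_intros continuous_on_component assms)

lemma borel_measurable_matrix_entry [measurable]:
  "(\<lambda>A::'a::real_normed_vector^'m^'n. A $ i $ j) \<in> borel_measurable borel"
  by (intro borel_measurable_continuous_onI continuous_intros continuous_on_component)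

section \<open>Gram--Schmidt and the QR factor\<close>

text \<open>Vectors of \<open>\<complex>\<^sup>d\<close> are modelled as functions on the index type; \<open>col G j\<close> is the
  \<open>j\<close>-th column of \<open>G\<close>.\<close>

definition hinner :: "('a::finite \<Rightarrow> complex) \<Rightarrow> ('a \<Rightarrow> complex) \<Rightarrow> complex" where
  "hinner u v = (\<Sum>i\<in>UNIV. cnj (u i) * v i)"

definition hnorm :: "('a::finite \<Rightarrow> complex) \<Rightarrow> real" where
  "hnorm u = sqrt (\<Sum>i\<in>UNIV. (cmod (u i))\<^sup>2)"

definition col :: "'a^'m^'n \<Rightarrow> 'm \<Rightarrow> 'n \<Rightarrow> 'a" where
  "col A j = (\<lambda>i. A $ i $ j)"

definition mat_app :: "complex^'m^'n \<Rightarrow> ('m::finite \<Rightarrow> complex) \<Rightarrow> 'n \<Rightarrow> complex" where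
  "mat_app A u = (\<lambda>i. \<Sum>l\<in>UNIV. A $ i $ l * u l)"

lemma hinner_cnj: "hinner v u = cnj (hinner u v)"
  by (simp add: hinner_def mult.commute)

lemma hnorm_squared: "(hnorm u)\<^sup>2 = (\<Sum>i\<in>UNIV. (cmod (u i))\<^sup>2)"
  by (simp add: hnorm_def sum_nonneg)

lemma hnorm_nonneg: "0 \<le> hnorm u"
  by (simp add: hnorm_def sum_nonneg)

lemma hinner_self: "hinner u u = of_real ((hnorm u)\<^sup>2)"
  unfolding hinner_def hnorm_squared of_real_sum
  by (intro sum.cong refl) (metis complex_norm_square mult.commute)

lemma hnorm_eq_0_iff: "hnorm u = 0 \<longleftrightarrow> u = (\<lambda>i. 0)"
  by (simp add: hnorm_def sum_nonneg_eq_0_iff sum_nonneg fun_eq_iff)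

lemma hinner_diff_sum_right:
  "hinner u (\<lambda>i. v i - (\<Sum>j\<in>J. c j * w j i)) = hinner u v - (\<Sum>j\<in>J. c j * hinner u (w j))"
  by (simp add: hinner_def sum_subtractf ring_distribs sum_distrib_left sum_distrib_right)
     (subst sum.swap, simp add: algebra_simps sum_distrib_left)

lemma hinner_divide_right: "hinner u (\<lambda>i. v i / c) = hinner u v / c"
  by (simp add: hinner_def sum_divide_distrib)

lemma hinner_divide_left: "hinner (\<lambda>i. v i / c) u = hinner v u / cnj c"
  by (simp add: hinner_def sum_divide_distrib)

lemma hinner_col_col: "hinner (col A i) (col B j) = (cadj A ** B) $ i $ j"
  by (simp add: hinner_def col_def matrix_matrix_mult_def)

lemma mat_app_col: "mat_app A (col B j) = col (A ** B) j"
  by (simp add: mat_app_def col_def matrix_matrix_mult_def)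

lemma mat_app_zero [simp]: "mat_app A (\<lambda>i. 0) = (\<lambda>i. 0)"
  by (simp add: mat_app_def fun_eq_iff)

lemma mat_app_diff_sum:
  "mat_app A (\<lambda>i. v i - (\<Sum>j\<in>J. c j * w j i)) = (\<lambda>i. mat_app A v i - (\<Sum>j\<in>J. c j * mat_app A (w j) i))"
  by (rule ext) (simp add: mat_app_def ring_distribs sum_subtractf sum_distrib_left mult_ac, subst sum.swap, simp)

lemma mat_app_divide: "mat_app A (\<lambda>i. v i / c) = (\<lambda>i. mat_app A v i / c)"
  by (rule ext) (simp add: mat_app_def sum_divide_distrib)

lemma hinner_mat_app_unitary:
  assumes "unitary_mat V" shows "hinner (mat_app V u) (mat_app V w) = hinner u w"
proof -
  have VV: "(\<Sum>i\<in>UNIV. cnj (V$i$l) * V$i$m) = (if l = m then 1 else 0)" for l m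
    using hinner_col_col[of V l V m] assms by (simp add: unitary_mat_def hinner_def col_def mat_def)
  have "hinner (mat_app V u) (mat_app V w)
      = (\<Sum>l\<in>UNIV. \<Sum>m\<in>UNIV. cnj (u l) * w m * (\<Sum>i\<in>UNIV. cnj (V$i$l) * V$i$m))"
    by (simp add: hinner_def mat_app_def sum_distrib_left sum_distrib_right mult_ac)
       (subst sum.swap, rule sum.cong[OF refl], subst sum.swap, simp)
  also have "\<dots> = hinner u w"
    by (simp add: VV hinner_def if_distrib cong: if_cong)
  finally show ?thesis .
qed

lemma hnorm_mat_app_unitary:
  assumes "unitary_mat V" shows "hnorm (mat_app V u) = hnorm u"
proof -
  have "(hnorm (mat_app V u))\<^sup>2 = (hnorm u)\<^sup>2"
    using hinner_mat_app_unitary[OF assms, of u u] by (simp only: hinner_self of_real_eq_iff)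
  thus ?thesis by (simp only: power2_eq_iff_nonneg hnorm_nonneg)
qed

lemma norm_unitary_entry_le:
  assumes "unitary_mat U" shows "cmod (U $ i $ j) \<le> 1"
proof -
  have "hinner (col U j) (col U j) = 1"
    using assms by (simp add: hinner_col_col unitary_mat_def mat_def)
  hence "(\<Sum>k\<in>UNIV. (cmod (U $ k $ j))\<^sup>2) = 1"
    by (simp only: hinner_self hnorm_squared col_def of_real_eq_1_iff)
  moreover have "(cmod (U $ i $ j))\<^sup>2 \<le> (\<Sum>k\<in>UNIV. (cmod (U $ k $ j))\<^sup>2)"
    by (rule member_le_sum) auto
  ultimately show ?thesis by (simp add: power_le_one_iff abs_le_iff)
qed

definition orth_residual ::
    "(nat \<Rightarrow> 'a::finite \<Rightarrow> complex) \<Rightarrow> nat \<Rightarrow> ('a \<Rightarrow> complex) \<Rightarrow> 'a \<Rightarrow> complex" where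
  "orth_residual f k g = (\<lambda>i. g i - (\<Sum>j<k. hinner (f j) g * f j i))"

definition hnormalize :: "('a::finite \<Rightarrow> complex) \<Rightarrow> 'a \<Rightarrow> complex" where
  "hnormalize u = (\<lambda>i. u i / of_real (hnorm u))"

text \<open>Gram--Schmidt on the columns \<open>e 0, e 1, \<dots>\<close> of \<open>G\<close>: after \<open>k\<close> steps the
  vectors with index \<open>j < k\<close> are filled in, the others are still zero.\<close>

primrec gram_schmidt :: "(nat \<Rightarrow> 'm) \<Rightarrow> complex^'m^'n \<Rightarrow> nat \<Rightarrow> nat \<Rightarrow> 'n::finite \<Rightarrow> complex" where
  "gram_schmidt e G 0 = (\<lambda>j i. 0)"
| "gram_schmidt e G (Suc k) =
     (gram_schmidt e G k)(k := hnormalize (orth_residual (gram_schmidt e G k) k (col G (e k))))"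

lemma hinner_orth_residual:
  assumes "\<forall>j<k. \<forall>l<k. hinner (f j) (f l) = (if j = l then 1 else 0)" and "j < k"
  shows "hinner (f j) (orth_residual f k g) = 0"
proof -
  have "(\<Sum>m<k. hinner (f m) g * hinner (f j) (f m)) = (\<Sum>m<k. if m = j then hinner (f j) g else 0)"
    using assms by (intro sum.cong refl) auto
  thus ?thesis
    unfolding orth_residual_def hinner_diff_sum_right using \<open>j < k\<close> by simp
qed

lemma hinner_hnormalize_right: "hinner u (hnormalize w) = hinner u w / of_real (hnorm w)"
  by (simp add: hnormalize_def hinner_divide_right)

lemma hinner_hnormalize_self: "w \<noteq> (\<lambda>i. 0) \<Longrightarrow> hinner (hnormalize w) (hnormalize w) = 1"
  by (simp add: hnormalize_def hinner_divide_right hinner_divide_left hinner_self hnorm_eq_0_iff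
      power2_eq_square)

lemma gram_schmidt_orthonormal:
  assumes "\<forall>m<k. orth_residual (gram_schmidt e G m) m (col G (e m)) \<noteq> (\<lambda>i. 0)"
  shows "\<forall>j<k. \<forall>l<k. hinner (gram_schmidt e G k j) (gram_schmidt e G k l) = (if j = l then 1 else 0)"
  using assms
proof (induction k)
  case 0 then show ?case by simp
next
  case (Suc k)
  define f where "f = gram_schmidt e G k"
  define w where "w = orth_residual f k (col G (e k))"
  have IH: "\<forall>j<k. \<forall>l<k. hinner (f j) (f l) = (if j = l then 1 else 0)"
    using Suc by (auto simp: f_def)
  have new_orth: "hinner (f j) (hnormalize w) = 0" if "j < k" for j
    using hinner_orth_residual[OF IH that] by (simp add: hinner_hnormalize_right w_def)
  have new_unit: "hinner (hnormalize w) (hnormalize w) = 1"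
    using Suc.prems by (intro hinner_hnormalize_self) (simp add: w_def f_def)
  have step: "gram_schmidt e G (Suc k) = f(k := hnormalize w)"
    by (simp add: f_def w_def)
  show ?case
    unfolding step
  proof (intro allI impI)
    fix j l assume "j < Suc k" "l < Suc k"
    then consider "j < k" "l < k" | "j < k" "l = k" | "j = k" "l < k" | "j = k" "l = k"
      by linarith
    then show "hinner ((f(k := hnormalize w)) j) ((f(k := hnormalize w)) l) = (if j = l then 1 else 0)"
    proof cases
      case 3
      then show ?thesis using new_orth[of l] by (subst hinner_cnj) simp
    qed (use IH new_orth new_unit in simp_all)
  qed
qed

lemma mat_app_orth_residual:
  assumes "unitary_mat V"
  shows "mat_app V (orth_residual f k g) = orth_residual (\<lambda>j. mat_app V (f j)) k (mat_app V g)"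
  unfolding orth_residual_def mat_app_diff_sum hinner_mat_app_unitary[OF assms] ..

lemma mat_app_hnormalize:
  "unitary_mat V \<Longrightarrow> mat_app V (hnormalize w) = hnormalize (mat_app V w)"
  by (simp add: hnormalize_def mat_app_divide hnorm_mat_app_unitary)

lemma gram_schmidt_mult_unitary:
  assumes "unitary_mat V"
  shows "gram_schmidt e (V ** G) k = (\<lambda>j. mat_app V (gram_schmidt e G k j))"
proof (induction k)
  case 0 then show ?case by simp
next
  case (Suc k)
  show ?case
    by (auto simp: Suc fun_eq_iff mat_app_col[symmetric] mat_app_orth_residual[OF assms]
        mat_app_hnormalize[OF assms])
qed

lemma mat_app_delta: "mat_app A (\<lambda>l. if l = a then 1 else 0) = col A a"
  by (simp add: mat_app_def col_def if_distrib cong: if_cong)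

lemma orth_residual_col_combination:
  assumes "\<And>j. j < k \<Longrightarrow> f j = mat_app G (Y j)"
  shows "orth_residual f k (col G a)
           = mat_app G (\<lambda>l. (if l = a then 1 else 0) - (\<Sum>j<k. hinner (f j) (col G a) * Y j l))"
  unfolding mat_app_diff_sum mat_app_delta orth_residual_def
  by (intro ext arg_cong2[where f="(-)"] refl sum.cong) (simp_all add: assms)

lemma gram_schmidt_in_column_span:
  "j < k \<Longrightarrow> \<exists>y. gram_schmidt e G k j = mat_app G y \<and> (\<forall>l. l \<notin> e ` {..j} \<longrightarrow> y l = 0)"
proof (induction k arbitrary: j)
  case 0 then show ?case by simp
next
  case (Suc k)
  from Suc.IH obtain Y where Y: "\<And>j. j < k \<Longrightarrow> gram_schmidt e G k j = mat_app G (Y j)"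
    and Y0: "\<And>j l. j < k \<Longrightarrow> l \<notin> e ` {..j} \<Longrightarrow> Y j l = 0"
    by metis
  define x where "x = (\<lambda>l. (if l = e k then 1 else 0)
                         - (\<Sum>j<k. hinner (gram_schmidt e G k j) (col G (e k)) * Y j l))"
  define w where "w = orth_residual (gram_schmidt e G k) k (col G (e k))"
  have "w = mat_app G x"
    unfolding w_def x_def by (rule orth_residual_col_combination) (rule Y)
  hence "gram_schmidt e G (Suc k) k = mat_app G (\<lambda>l. x l / of_real (hnorm w))"
    by (simp add: w_def hnormalize_def mat_app_divide)
  moreover have "x l = 0" if l: "l \<notin> e ` {..k}" for l
  proof -
    have "Y j l = 0" if "j < k" for j
      using l that by (intro Y0) auto
    with l show ?thesis by (force simp: x_def)
  qed
  ultimately show ?case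
    using Suc.prems Suc.IH by (cases "j = k") auto
qed

lemma mat_app_eq_matrix_vector_mult: "mat_app A u = (\<lambda>i. (A *v (\<chi> l. u l)) $ i)"
  by (simp add: mat_app_def matrix_vector_mult_def)

lemma orth_residual_nonzero_if_det:
  fixes G :: "complex^'d::finite^'d"
  assumes det: "det G \<noteq> 0" and e: "inj_on e {..m}"
  shows "orth_residual (gram_schmidt e G m) m (col G (e m)) \<noteq> (\<lambda>i. 0)"
proof
  assume zero: "orth_residual (gram_schmidt e G m) m (col G (e m)) = (\<lambda>i. 0)"
  obtain Y where Y: "\<And>j. j < m \<Longrightarrow> gram_schmidt e G m j = mat_app G (Y j)"
    and Y0: "\<And>j l. j < m \<Longrightarrow> l \<notin> e ` {..j} \<Longrightarrow> Y j l = 0"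
    using gram_schmidt_in_column_span[of _ m e G] by metis
  define x where "x = (\<chi> l. (if l = e m then 1 else 0)
                         - (\<Sum>j<m. hinner (gram_schmidt e G m j) (col G (e m)) * Y j l))"
  have "G *v x = 0"
    using zero orth_residual_col_combination[of m "gram_schmidt e G m" G Y "e m", OF Y]
    by (simp add: mat_app_eq_matrix_vector_mult x_def fun_eq_iff vec_eq_iff)
  moreover have "Y j (e m) = 0" if "j < m" for j
    using Y0[OF that] inj_on_image_mem_iff[OF e, of m "{..j}"] that by auto
  hence "x $ e m = 1" by (simp add: x_def)
  moreover have "\<exists>B. B ** G = mat 1"
    using det invertible_det_nz invertible_left_inverse by blast
  ultimately show False
    using matrix_left_invertible_ker by force
qed

text \<open>The unitary factor of the QR decomposition; the bijection
  \<open>e : {..<d} \<rightarrow> 'd\<close> fixes the order in which the columns are orthonormalised.\<close>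

definition q_factor :: "(nat \<Rightarrow> 'd) \<Rightarrow> complex^'d^'d \<Rightarrow> complex^'d::finite^'d" where
  "q_factor e G = (\<chi> i j. gram_schmidt e G CARD('d) (inv_into {..<CARD('d)} e j) i)"

lemma q_factor_mult_unitary:
  assumes "unitary_mat V" shows "q_factor e (V ** G) = V ** q_factor e G"
  unfolding q_factor_def gram_schmidt_mult_unitary[OF assms]
  by (simp add: vec_eq_iff matrix_matrix_mult_def mat_app_def)

lemma col_q_factor:
  "col (q_factor e (G::complex^'d::finite^'d)) a = gram_schmidt e G CARD('d) (inv_into {..<CARD('d)} e a)"
  by (simp add: col_def q_factor_def)

lemma unitary_q_factor:
  assumes e: "bij_betw e {..<CARD('d)} (UNIV::'d::finite set)" and det: "det G \<noteq> 0"
  shows "unitary_mat (q_factor e G)"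
proof -
  let ?ei = "inv_into {..<CARD('d)} e"
  have ei: "?ei a < CARD('d)" for a
    using e by (meson UNIV_I bij_betwE bij_betw_inv_into lessThan_iff)
  have ei_eq: "?ei a = ?ei b \<longleftrightarrow> a = b" for a b
    using e by (metis UNIV_I bij_betw_inv_into_right)
  have "inj_on e {..m}" if "m < CARD('d)" for m
    using e that by (auto simp: bij_betw_def intro: inj_on_subset)
  hence "\<forall>m<CARD('d). orth_residual (gram_schmidt e G m) m (col G (e m)) \<noteq> (\<lambda>i. 0)"
    using orth_residual_nonzero_if_det[OF det] by blast
  from gram_schmidt_orthonormal[OF this]
  have "(cadj (q_factor e G) ** q_factor e G) $ a $ b = (if a = b then 1 else 0)" for a b
    using ei ei_eq by (simp add: hinner_col_col[symmetric] col_q_factor)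
  thus ?thesis by (simp add: unitary_mat_iff_left vec_eq_iff mat_def)
qed

lemma borel_measurable_vec_lambda:
  fixes f :: "'a \<Rightarrow> 'b::euclidean_space^'n"
  assumes "\<And>i. (\<lambda>x. f x $ i) \<in> borel_measurable M"
  shows "f \<in> borel_measurable M"
proof (subst borel_measurable_euclidean_space, intro ballI)
  fix b :: "'b^'n" assume "b \<in> Basis"
  then obtain i u where b: "b = axis i u" and u: "u \<in> Basis" by (auto simp: Basis_vec_def)
  have "(\<lambda>x. f x $ i \<bullet> u) \<in> borel_measurable M" using assms[of i] by measurable
  thus "(\<lambda>x. f x \<bullet> b) \<in> borel_measurable M" by (simp add: b inner_axis)
qed

lemma borel_measurable_cnj [measurable]: "cnj \<in> borel_measurable borel"
  by (intro borel_measurable_continuous_onI continuous_intros)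

lemma borel_measurable_gram_schmidt [measurable]:
  "(\<lambda>G::complex^'m^'n::finite. gram_schmidt e G k j i) \<in> borel_measurable borel"
proof (induction k arbitrary: j i)
  case (Suc k)
  note [measurable] = Suc.IH
  have [measurable]:
    "(\<lambda>G::complex^'m^'n. orth_residual (gram_schmidt e G k) k (col G (e k)) i) \<in> borel_measurable borel" for i
    unfolding orth_residual_def hinner_def col_def
    by (intro borel_measurable_diff borel_measurable_sum borel_measurable_times Suc.IH
        borel_measurable_matrix_entry measurable_compose[OF Suc.IH borel_measurable_cnj])
  have "(\<lambda>G::complex^'m^'n. hnormalize (orth_residual (gram_schmidt e G k) k (col G (e k))) i) \<in> borel_measurable borel"
    for i unfolding hnormalize_def hnorm_def by measurable
  then show ?case by (cases "j = k") (simp_all add: Suc.IH)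
qed simp

lemma borel_measurable_q_factor [measurable]: "q_factor e \<in> borel_measurable borel"
  unfolding q_factor_def by (intro borel_measurable_vec_lambda) simp

section \<open>Existence of a Haar measure\<close>

text \<open>Real coordinates on \<open>\<complex>\<^sup>d\<^sup>\<times>\<^sup>d\<close>, given by a bijection \<open>b\<close> of the real
  and imaginary parts of the entries onto an index type: invariance of Lebesgue measure
  under orthogonal maps is available only on spaces \<open>real^'n\<close>.\<close>

definition of_coords :: "('d \<times> 'd \<times> bool \<Rightarrow> 'k) \<Rightarrow> real^'k \<Rightarrow> complex^'d^'d" where
  "of_coords b x = (\<chi> i j. Complex (x $ b (i, j, False)) (x $ b (i, j, True)))"

definition coords :: "('d \<times> 'd \<times> bool \<Rightarrow> 'k) \<Rightarrow> complex^'d^'d \<Rightarrow> real^'k" where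
  "coords b G = (\<chi> k. case inv b k of (i, j, t) \<Rightarrow> if t then Im (G $ i $ j) else Re (G $ i $ j))"

lemma of_coords_coords [simp]: "bij b \<Longrightarrow> of_coords b (coords b G) = G"
  by (simp add: of_coords_def coords_def vec_eq_iff complex_eq_iff bij_is_inj inv_f_f)

lemma inner_of_coords:
  fixes b :: "'d::finite \<times> 'd \<times> bool \<Rightarrow> 'k::finite"
  assumes "bij b" shows "of_coords b x \<bullet> of_coords b y = x \<bullet> y"
proof -
  have "of_coords b x \<bullet> of_coords b y = (\<Sum>i\<in>UNIV. \<Sum>j\<in>UNIV. \<Sum>t\<in>UNIV. x $ b (i, j, t) * y $ b (i, j, t))"
    by (simp add: inner_vec_def inner_complex_def of_coords_def UNIV_bool add.commute)
  also have "\<dots> = (\<Sum>p\<in>UNIV. x $ b p * y $ b p)"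
    by (simp add: sum.cartesian_product UNIV_Times_UNIV[symmetric] del: UNIV_Times_UNIV)
  also have "\<dots> = x \<bullet> y"
    using sum.reindex_bij_betw[OF assms[unfolded bij_betw_def[symmetric]]]
    by (simp add: inner_vec_def)
  finally show ?thesis .
qed

lemma linear_of_coords: "linear (of_coords b)"
  by (rule linearI) (simp_all add: of_coords_def vec_eq_iff complex_eq_iff)

lemma linear_coords: "linear (coords b)"
  by (rule linearI) (simp_all add: coords_def vec_eq_iff split: prod.splits)

lemma norm_coords: "bij b \<Longrightarrow> norm (coords b G) = norm G"
  using inner_of_coords[of b "coords b G" "coords b G"] by (simp add: norm_eq_sqrt_inner)

lemma inner_matrix_mult_unitary:
  fixes G H :: "complex^'d::finite^'d"
  assumes "unitary_mat V" shows "(V ** G) \<bullet> (V ** H) = G \<bullet> H"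
proof -
  have "G \<bullet> H = Re (\<Sum>j\<in>UNIV. hinner (col G j) (col H j))" for G H :: "complex^'d^'d"
    by (simp add: inner_vec_def inner_complex_def hinner_def col_def Re_sum) (rule sum.swap)
  thus ?thesis by (simp add: mat_app_col[symmetric] hinner_mat_app_unitary[OF assms])
qed

definition coords_left_mult :: "('d \<times> 'd \<times> bool \<Rightarrow> 'k) \<Rightarrow> complex^'d^'d \<Rightarrow> real^'k \<Rightarrow> real^'k" where
  "coords_left_mult b V x = coords b (V ** of_coords b x)"

lemma of_coords_coords_left_mult: "bij b \<Longrightarrow> of_coords b (coords_left_mult b V x) = V ** of_coords b x"
  by (simp add: coords_left_mult_def)

lemma linear_coords_left_mult:
  fixes b :: "'d::finite \<times> 'd \<times> bool \<Rightarrow> 'k::finite"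
  shows "linear (coords_left_mult b V)"
proof -
  have "linear (\<lambda>G::complex^'d^'d. V ** G)"
    by (rule linearI)
       (simp_all add: vec_eq_iff matrix_matrix_mult_def sum.distrib distrib_left scaleR_sum_right)
  thus ?thesis
    unfolding coords_left_mult_def[abs_def]
    using linear_compose[OF linear_compose[OF linear_of_coords] linear_coords] by (simp add: o_def)
qed

lemma orthogonal_transformation_coords_left_mult:
  fixes b :: "'d::finite \<times> 'd \<times> bool \<Rightarrow> 'k::finite"
  assumes "bij b" "unitary_mat V"
  shows "orthogonal_transformation (coords_left_mult b V)"
  unfolding orthogonal_transformation_def
  using assms by (simp add: linear_coords_left_mult coords_left_mult_def inner_of_coords[symmetric]
      inner_matrix_mult_unitary)

lemma emeasure_orthogonal_image:
  fixes T :: "real^'n::{finite,wellorder} \<Rightarrow> real^'n::{finite,wellorder}"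
  assumes T: "orthogonal_transformation T" and S: "S \<in> sets borel" "bounded S"
    and TS: "T ` S \<in> sets borel"
  shows "emeasure lborel (T ` S) = emeasure lborel S"
proof -
  have S_leb: "S \<in> lmeasurable"
    using S by (intro bounded_set_imp_lmeasurable) (auto intro: sets_completionI_sets)
  have "emeasure lborel (T ` S) = emeasure lebesgue (T ` S)" using TS by simp
  also have "\<dots> = ennreal (measure lebesgue (T ` S))"
    by (rule emeasure_eq_measure2[OF measurable_orthogonal_image[OF T S_leb]])
  also have "\<dots> = ennreal (measure lebesgue S)" by (simp add: measure_orthogonal_image[OF T S_leb])
  also have "\<dots> = emeasure lebesgue S" by (rule emeasure_eq_measure2[OF S_leb, symmetric])
  also have "\<dots> = emeasure lborel S" using S by simp
  finally show ?thesis .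
qed

lemma distr_uniform_measure_orthogonal:
  fixes T :: "real^'n::{finite,wellorder} \<Rightarrow> real^'n::{finite,wellorder}"
  assumes T: "orthogonal_transformation T" and B: "B \<in> sets borel" "bounded B"
    and invariant: "T -` B = B"
  shows "distr (uniform_measure lborel B) borel T = uniform_measure lborel B"
proof (rule measure_eqI)
  have T_meas [measurable]: "T \<in> borel_measurable borel"
    using T by (intro borel_measurable_continuous_onI linear_continuous_on)
       (simp add: orthogonal_transformation_linear linear_conv_bounded_linear[symmetric])
  fix A assume "A \<in> sets (distr (uniform_measure lborel B) borel T)"
  hence A [measurable]: "A \<in> sets borel" by simp
  have pre: "B \<inter> T -` A = inv T ` (B \<inter> A)"
    using invariant bij_vimage_eq_inv_image[OF orthogonal_transformation_bij[OF T], of "B \<inter> A"]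
    by auto
  have "emeasure lborel (inv T ` (B \<inter> A)) = emeasure lborel (B \<inter> A)"
  proof (rule emeasure_orthogonal_image[OF orthogonal_transformation_inv[OF T]])
    show "bounded (B \<inter> A)" using B by (auto intro: bounded_subset)
    have "T -` (B \<inter> A) \<in> sets borel" using B A by (intro measurable_sets_borel[OF T_meas]) auto
    thus "inv T ` (B \<inter> A) \<in> sets borel"
      using bij_vimage_eq_inv_image[OF orthogonal_transformation_bij[OF T]] by metis
  qed (use B in simp)
  thus "emeasure (distr (uniform_measure lborel B) borel T) A = emeasure (uniform_measure lborel B) A"
    using B by (simp add: emeasure_distr pre[symmetric] measurable_sets_borel[OF T_meas A])
qed simp

lemma emeasure_lborel_open_pos:
  fixes S :: "'a::euclidean_space set"
  assumes "open S" "x \<in> S" shows "0 < emeasure lborel S"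
proof -
  obtain r where "r > 0" "ball x r \<subseteq> S" using assms open_contains_ball by blast
  hence "0 < emeasure lborel (ball x r)" by (simp add: emeasure_ball)
  also have "\<dots> \<le> emeasure lborel S"
    using \<open>ball x r \<subseteq> S\<close> \<open>open S\<close> by (intro emeasure_mono) auto
  finally show ?thesis .
qed

lemma borel_measurable_matrix_mult [measurable (raw)]:
  fixes f g :: "'a \<Rightarrow> complex^'d::finite^'d"
  assumes "f \<in> borel_measurable M" "g \<in> borel_measurable M"
  shows "(\<lambda>x. f x ** g x) \<in> borel_measurable M"
proof -
  have "(\<lambda>p::(complex^'d^'d) \<times> (complex^'d^'d). fst p ** snd p) \<in> borel_measurable borel"
    by (intro borel_measurable_continuous_onI continuous_intros)
  hence "(\<lambda>p::(complex^'d^'d) \<times> (complex^'d^'d). fst p ** snd p)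
           \<in> borel_measurable (borel \<Otimes>\<^sub>M borel)"
    by (simp add: borel_prod)
  from measurable_compose[OF measurable_Pair[OF assms] this] show ?thesis by simp
qed

lemma borel_measurable_cadj [measurable (raw)]:
  fixes f :: "'a \<Rightarrow> complex^'d::finite^'d"
  assumes "f \<in> borel_measurable M"
  shows "(\<lambda>x. cadj (f x)) \<in> borel_measurable M"
proof -
  have "(cadj :: complex^'d^'d \<Rightarrow> _) \<in> borel_measurable borel"
    by (intro borel_measurable_continuous_onI continuous_on_cadj continuous_on_id)
  from measurable_compose[OF assms this] show ?thesis .
qed

lemma sets_borel_unitary [measurable]: "{U::complex^'d::finite^'d. unitary_mat U} \<in> sets borel"
proof -
  have "closed {U::complex^'d^'d. cadj U ** U = mat 1}"
    by (intro closed_Collect_eq continuous_intros)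
  thus ?thesis by (simp add: unitary_mat_iff_left)
qed

lemma pred_unitary [measurable]: "Measurable.pred borel (unitary_mat :: complex^'d::finite^'d \<Rightarrow> bool)"
  using pred_sets1[where P=unitary_mat and N=borel and f="\<lambda>x. x" and M=borel] sets_borel_unitary
  by simp

lemma borel_measurable_of_coords [measurable]: "of_coords b \<in> borel_measurable borel"
  by (intro borel_measurable_continuous_onI linear_continuous_on)
     (simp add: linear_conv_bounded_linear[symmetric] linear_of_coords)

lemma borel_measurable_coords_left_mult [measurable]:
  fixes b :: "'d::finite \<times> 'd \<times> bool \<Rightarrow> 'k::finite"
  shows "coords_left_mult b V \<in> borel_measurable borel"
  by (intro borel_measurable_continuous_onI linear_continuous_on)
     (simp add: linear_conv_bounded_linear[symmetric] linear_coords_left_mult)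

lemma is_haar_distr_q_factor:
  fixes b :: "'d::finite \<times> 'd \<times> bool \<Rightarrow> 'k::finite"
  assumes b: "bij b" and e: "bij_betw e {..<CARD('d)} UNIV"
    and P: "prob_space P" and sets_P [measurable_cong]: "sets P = sets borel"
    and invertible: "AE x in P. det (of_coords b x) \<noteq> 0"
    and invariant: "\<And>V. unitary_mat V \<Longrightarrow> distr P borel (coords_left_mult b V) = P"
  shows "is_haar (distr P borel (\<lambda>x. q_factor e (of_coords b x)))"
  unfolding is_haar_def
proof (intro conjI allI impI)
  show "prob_space (distr P borel (\<lambda>x. q_factor e (of_coords b x)))"
    by (intro prob_space.prob_space_distr P) measurable
  show "AE U in distr P borel (\<lambda>x. q_factor e (of_coords b x)). unitary_mat U"
    using invertible by (subst AE_distr_iff) (auto elim!: eventually_mono intro: unitary_q_factor e)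
  fix V :: "complex^'d^'d" assume V: "unitary_mat V"
  have "distr (distr P borel (\<lambda>x. q_factor e (of_coords b x))) borel ((**) V)
      = distr P borel ((\<lambda>x. q_factor e (of_coords b x)) \<circ> coords_left_mult b V)"
    by (subst distr_distr) (auto simp: o_def q_factor_mult_unitary[OF V] of_coords_coords_left_mult b)
  also have "\<dots> = distr (distr P borel (coords_left_mult b V)) borel (\<lambda>x. q_factor e (of_coords b x))"
    by (rule distr_distr[symmetric]) measurable
  finally show "distr (distr P borel (\<lambda>x. q_factor e (of_coords b x))) borel ((**) V)
      = distr P borel (\<lambda>x. q_factor e (of_coords b x))"
    by (simp add: invariant[OF V])
qed simp

definition invertible_ball :: "('d::finite \<times> 'd \<times> bool \<Rightarrow> 'k::finite) \<Rightarrow> (real^'k) set" where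
  "invertible_ball b = {x. norm x < 1 \<and> det (of_coords b x) \<noteq> 0}"

lemma open_invertible_ball: "open (invertible_ball (b :: 'd::finite \<times> 'd \<times> bool \<Rightarrow> 'k::finite))"
  unfolding invertible_ball_def
  by (intro open_Collect_conj open_Collect_less open_Collect_neq continuous_intros
      linear_continuous_on) (simp add: linear_conv_bounded_linear[symmetric] linear_of_coords)

lemma bounded_invertible_ball: "bounded (invertible_ball b)"
  unfolding invertible_ball_def bounded_iff by (intro exI[of _ 1]) auto

lemma vimage_coords_left_mult_invertible_ball:
  fixes b :: "'d::finite \<times> 'd \<times> bool \<Rightarrow> 'k::finite"
  assumes b: "bij b" and V: "unitary_mat V"
  shows "coords_left_mult b V -` invertible_ball b = invertible_ball b"
  using orthogonal_transformation_norm[OF orthogonal_transformation_coords_left_mult[OF b V]]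
  by (auto simp: invertible_ball_def of_coords_coords_left_mult b det_mul det_unitary_nonzero[OF V])

lemma emeasure_invertible_ball_nonzero:
  fixes b :: "'d::finite \<times> 'd \<times> bool \<Rightarrow> 'k::finite"
  assumes b: "bij b"
  shows "emeasure lborel (invertible_ball b) \<noteq> 0"
proof -
  define c where "c = 1 / (norm (mat 1 :: complex^'d^'d) + 1)"
  define x0 where "x0 = coords b (c *\<^sub>R mat 1)"
  have "c > 0" "c * norm (mat 1 :: complex^'d^'d) < 1"
    unfolding c_def using norm_ge_zero[of "mat 1 :: complex^'d^'d"] by (simp_all add: add_nonneg_pos)
  hence "norm x0 < 1"
    by (simp add: x0_def b norm_coords)
  moreover have "c *\<^sub>R mat 1 = (mat (of_real c) :: complex^'d^'d)"
    by (simp add: vec_eq_iff mat_def of_real_def)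
  hence "det (of_coords b x0) = of_real c ^ CARD('d)"
    by (simp add: x0_def b det_diagonal mat_def)
  ultimately have "x0 \<in> invertible_ball b"
    using \<open>c > 0\<close> by (simp add: invertible_ball_def)
  thus ?thesis
    using emeasure_lborel_open_pos[OF open_invertible_ball] by (metis less_numeral_extra(3))
qed

theorem ex_is_haar: "\<exists>M::(complex^'d::finite^'d) measure. is_haar M"
proof -
  obtain e where e: "bij_betw e {..<CARD('d)} (UNIV::'d set)"
    using ex_bij_betw_nat_finite[of "UNIV::'d set"] by (auto simp: atLeast0LessThan)
  have "card (UNIV::('d \<times> 'd \<times> bool) set) = card (UNIV::(('d \<times> 'd) bit0) set)"
    by (simp add: card_UNIV_bool)
  then obtain b :: "'d \<times> 'd \<times> bool \<Rightarrow> ('d \<times> 'd) bit0" where b: "bij b"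
    using finite_same_card_bij[of "UNIV::('d \<times> 'd \<times> bool) set" "UNIV::(('d \<times> 'd) bit0) set"]
    by auto
  let ?B = "invertible_ball b"
  have B_borel: "?B \<in> sets borel"
    using open_invertible_ball[of b] by simp
  have "prob_space (uniform_measure lborel ?B)"
    using emeasure_invertible_ball_nonzero[OF b] emeasure_bounded_finite[OF bounded_invertible_ball[of b]]
    by (intro prob_space_uniform_measure) auto
  moreover have "AE x in uniform_measure lborel ?B. det (of_coords b x) \<noteq> 0"
    using B_borel by (intro AE_uniform_measureI) (auto simp: invertible_ball_def)
  moreover have "distr (uniform_measure lborel ?B) borel (coords_left_mult b V) = uniform_measure lborel ?B"
    if "unitary_mat V" for V
    by (intro distr_uniform_measure_orthogonal orthogonal_transformation_coords_left_mult
        vimage_coords_left_mult_invertible_ball b that B_borel bounded_invertible_ball)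
  ultimately have "is_haar (distr (uniform_measure lborel ?B) borel (\<lambda>x. q_factor e (of_coords b x)))"
    by (intro is_haar_distr_q_factor[OF b e]) auto
  thus ?thesis by blast
qed

section \<open>Invariance of Haar integrals\<close>

lemma is_haar_haar: "is_haar (haar :: (complex^'d::finite^'d) measure)"
  unfolding haar_def using ex_is_haar by (rule someI_ex)

lemma prob_space_haar: "prob_space (haar :: (complex^'d::finite^'d) measure)"
  using is_haar_haar unfolding is_haar_def by blast

lemma sets_haar [measurable_cong, simp]: "sets (haar :: (complex^'d::finite^'d) measure) = sets borel"
  using is_haar_haar unfolding is_haar_def by blast

lemma space_haar [simp]: "space (haar :: (complex^'d::finite^'d) measure) = UNIV"
  using sets_eq_imp_space_eq[OF sets_haar] by simp

lemma measure_haar_UNIV [simp]: "measure (haar :: (complex^'d::finite^'d) measure) UNIV = 1"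
  using prob_space.prob_space[OF prob_space_haar] by simp

lemma AE_haar_unitary: "AE U in (haar :: (complex^'d::finite^'d) measure). unitary_mat U"
  using is_haar_haar unfolding is_haar_def by blast

lemma distr_haar_left_mult:
  "unitary_mat V \<Longrightarrow> distr (haar :: (complex^'d::finite^'d) measure) borel ((**) V) = haar"
  using is_haar_haar unfolding is_haar_def by blast

interpretation haar: prob_space "haar :: (complex^'d::finite^'d) measure"
  by (rule prob_space_haar)

interpretation haar_pair: pair_prob_space "haar :: (complex^'d::finite^'d) measure" haar
  by unfold_locales

lemma integral_haar_left_mult:
  fixes f :: "complex^'d::finite^'d \<Rightarrow> 'b::{banach, second_countable_topology}"
  assumes "unitary_mat V" and [measurable]: "f \<in> borel_measurable borel"
  shows "(\<integral>U. f (V ** U) \<partial>haar) = (\<integral>U. f U \<partial>haar)"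
  using integral_distr[of "(**) V" haar borel f] by (simp add: distr_haar_left_mult[OF assms(1)])

text \<open>Inversion invariance, by Fubini: both sides equal \<open>\<integral>\<integral> f (V\<^sup>* U) dU dV\<close>,
  integrating first over \<open>U\<close> respectively over \<open>V\<close> and using left invariance.\<close>

lemma integral_haar_cadj:
  fixes f :: "complex^'d::finite^'d \<Rightarrow> 'b::{banach, second_countable_topology}"
  assumes f [measurable]: "f \<in> borel_measurable borel" and bounded: "\<And>U. norm (f U) \<le> C"
  shows "(\<integral>U. f (cadj U) \<partial>haar) = (\<integral>U. f U \<partial>haar)"
proof -
  let ?H = "haar :: (complex^'d^'d) measure"
  have [measurable]: "(\<lambda>(U, V). f (cadj V ** U)) \<in> borel_measurable (?H \<Otimes>\<^sub>M ?H)"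
    by measurable
  have "(\<integral>U. f U \<partial>?H) = (\<integral>V. (\<integral>U. f U \<partial>?H) \<partial>?H)"
    by simp
  also have "\<dots> = (\<integral>V. (\<integral>U. f (cadj V ** U) \<partial>?H) \<partial>?H)"
  proof (rule integral_cong_AE)
    show "AE V in ?H. (\<integral>U. f U \<partial>?H) = (\<integral>U. f (cadj V ** U) \<partial>?H)"
      using AE_haar_unitary by eventually_elim (simp add: integral_haar_left_mult unitary_mat_cadj)
  qed measurable
  also have "\<dots> = (\<integral>U. (\<integral>V. f (cadj V ** U) \<partial>?H) \<partial>?H)"
    by (rule haar_pair.Fubini_integral, rule haar_pair.P.integrable_const_bound[where B=C])
       (auto simp: bounded)
  also have "\<dots> = (\<integral>U. (\<integral>V. f (cadj V) \<partial>?H) \<partial>?H)"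
  proof (rule integral_cong_AE)
    show "AE U in ?H. (\<integral>V. f (cadj V ** U) \<partial>?H) = (\<integral>V. f (cadj V) \<partial>?H)"
      using AE_haar_unitary
    proof eventually_elim
      case (elim U)
      have "(\<integral>V. f (cadj V ** U) \<partial>?H) = (\<integral>V. f (cadj (U ** V) ** U) \<partial>?H)"
        by (rule integral_haar_left_mult[OF elim, symmetric]) measurable
      also have "\<dots> = (\<integral>V. f (cadj V) \<partial>?H)"
        using elim by (simp add: cadj_mult matrix_mul_assoc[symmetric] unitary_mat_def)
      finally show ?case .
    qed
  qed measurable
  finally show ?thesis by simp
qed

lemma integral_haar_right_mult:
  fixes f :: "complex^'d::finite^'d \<Rightarrow> 'b::{banach, second_countable_topology}"
  assumes W: "unitary_mat W" and f [measurable]: "f \<in> borel_measurable borel"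
    and bounded: "\<And>U. unitary_mat U \<Longrightarrow> norm (f U) \<le> C"
  shows "(\<integral>U. f (U ** W) \<partial>haar) = (\<integral>U. f U \<partial>haar)"
proof -
  \<comment> \<open>\<open>f\<close> is bounded only on unitaries, so truncate it before using \<open>integral_haar_cadj\<close>\<close>
  define g where "g U = (if unitary_mat U then f U else 0)" for U
  have g [measurable]: "g \<in> borel_measurable borel" unfolding g_def by measurable
  have g_bounded: "norm (g U) \<le> max C 0" for U by (simp add: g_def bounded le_max_iff_disj)
  have "(\<integral>U. f (U ** W) \<partial>haar) = (\<integral>U. g (U ** W) \<partial>haar)"
    using AE_haar_unitary
    by (intro integral_cong_AE) (auto simp: g_def unitary_mat_mult W elim!: eventually_mono)
  also have "\<dots> = (\<integral>U. g (cadj U ** W) \<partial>haar)"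
    by (rule integral_haar_cadj[where f="\<lambda>U. g (U ** W)", symmetric]) (auto intro: g_bounded)
  also have "\<dots> = (\<integral>U. g (cadj (cadj W ** U)) \<partial>haar)"
    by (simp add: cadj_mult)
  also have "\<dots> = (\<integral>U. g (cadj U) \<partial>haar)"
    by (rule integral_haar_left_mult[OF unitary_mat_cadj[OF W]]) measurable
  also have "\<dots> = (\<integral>U. g U \<partial>haar)"
    by (rule integral_haar_cadj) (auto intro: g_bounded)
  also have "\<dots> = (\<integral>U. f U \<partial>haar)"
    using AE_haar_unitary
    by (intro integral_cong_AE) (auto simp: g_def elim!: eventually_mono)
  finally show ?thesis .
qed

section \<open>Second moments of a conjugated matrix\<close>

definition adj_conj :: "complex^'d^'d \<Rightarrow> complex^'d^'d \<Rightarrow> complex^'d::finite^'d" where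
  "adj_conj X U = cadj U ** X ** U"

definition second_moment :: "complex^'d^'d \<Rightarrow> 'd \<Rightarrow> 'd \<Rightarrow> 'd \<Rightarrow> 'd \<Rightarrow> complex" where
  "second_moment X a b c e = (\<integral>U. adj_conj X U $ a $ b * cnj (adj_conj X U $ c $ e) \<partial>haar)"

lemma adj_conj_nth:
  "adj_conj X W $ a $ b = (\<Sum>p\<in>UNIV. \<Sum>q\<in>UNIV. cnj (W $ p $ a) * X $ p $ q * W $ q $ b)"
  by (simp add: adj_conj_def matrix_matrix_mult_def sum_distrib_right) (rule sum.swap)

lemma adj_conj_right_mult: "adj_conj X (U ** W) = adj_conj (adj_conj X U) W"
  by (simp add: adj_conj_def cadj_mult matrix_mul_assoc)

lemma norm_adj_conj_nth_le:
  assumes U: "unitary_mat U"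
  shows "cmod (adj_conj X U $ a $ b) \<le> (\<Sum>p\<in>UNIV. \<Sum>q\<in>UNIV. cmod (X $ p $ q))"
proof -
  have "cmod (adj_conj X U $ a $ b) \<le> (\<Sum>p\<in>UNIV. \<Sum>q\<in>UNIV. cmod (cnj (U$p$a) * X$p$q * U$q$b))"
    unfolding adj_conj_nth by (intro order.trans[OF norm_sum] sum_mono norm_sum)
  also have "\<dots> \<le> (\<Sum>p\<in>UNIV. \<Sum>q\<in>UNIV. cmod (X $ p $ q))"
  proof (intro sum_mono)
    fix p q
    have "cmod (cnj (U$p$a) * X$p$q * U$q$b) = cmod (U$p$a) * cmod (X$p$q) * cmod (U$q$b)"
      by (simp add: norm_mult)
    also have "\<dots> \<le> 1 * cmod (X$p$q) * 1"
      using norm_unitary_entry_le[OF U] by (intro mult_mono) auto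
    finally show "cmod (cnj (U$p$a) * X$p$q * U$q$b) \<le> cmod (X$p$q)" by simp
  qed
  finally show ?thesis .
qed

lemma borel_measurable_adj_conj_nth [measurable]:
  "(\<lambda>U. adj_conj X U $ a $ b) \<in> borel_measurable borel"
  unfolding adj_conj_def by measurable

lemma norm_second_moment_integrand_le:
  "unitary_mat U \<Longrightarrow>
    norm (adj_conj X U $ a $ b * cnj (adj_conj X U $ c $ e)) \<le> (\<Sum>p\<in>UNIV. \<Sum>q\<in>UNIV. cmod (X $ p $ q))\<^sup>2"
  unfolding norm_mult complex_mod_cnj power2_eq_square
  by (intro mult_mono norm_adj_conj_nth_le) (auto intro!: sum_nonneg)

lemma integrable_second_moment_integrand:
  "integrable haar (\<lambda>U. adj_conj X U $ a $ b * cnj (adj_conj X U $ c $ e))"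
  using AE_haar_unitary
  by (intro haar.integrable_const_bound[where B="(\<Sum>p\<in>UNIV. \<Sum>q\<in>UNIV. cmod (X $ p $ q))\<^sup>2"])
     (auto elim!: eventually_mono intro: norm_second_moment_integrand_le)

lemma sum_product_sum:
  "(\<Sum>p\<in>A. \<Sum>q\<in>B. F p q) * (\<Sum>r\<in>C. \<Sum>s\<in>D. G r s)
     = (\<Sum>p\<in>A. \<Sum>q\<in>B. \<Sum>r\<in>C. \<Sum>s\<in>D. (F p q * G r s :: 'a::comm_semiring_0))"
  unfolding sum_distrib_right by (simp only: sum_distrib_left)

lemma second_moment_right_mult:
  assumes W: "unitary_mat W"
  shows "second_moment X a b c e = (\<Sum>p\<in>UNIV. \<Sum>q\<in>UNIV. \<Sum>r\<in>UNIV. \<Sum>s\<in>UNIV.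
            (cnj (W$p$a) * W$q$b * W$r$c * cnj (W$s$e)) * second_moment X p q r s)"
proof -
  have "second_moment X a b c e
      = (\<integral>U. adj_conj X (U ** W) $ a $ b * cnj (adj_conj X (U ** W) $ c $ e) \<partial>haar)"
    unfolding second_moment_def
    by (rule integral_haar_right_mult[OF W, symmetric]) (auto intro: norm_second_moment_integrand_le)
  also have "\<dots> = (\<integral>U. (\<Sum>p\<in>UNIV. \<Sum>q\<in>UNIV. \<Sum>r\<in>UNIV. \<Sum>s\<in>UNIV.
            (cnj (W$p$a) * W$q$b * W$r$c * cnj (W$s$e)) *
            (adj_conj X U $ p $ q * cnj (adj_conj X U $ r $ s))) \<partial>haar)"
    unfolding adj_conj_right_mult adj_conj_nth[of "adj_conj X U" W for U] cnj_sum sum_product_sum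
    by (intro Bochner_Integration.integral_cong refl sum.cong) (simp add: mult_ac)
  also have "\<dots> = (\<Sum>p\<in>UNIV. \<Sum>q\<in>UNIV. \<Sum>r\<in>UNIV. \<Sum>s\<in>UNIV.
            (cnj (W$p$a) * W$q$b * W$r$c * cnj (W$s$e)) * second_moment X p q r s)"
    unfolding second_moment_def
    by (simp add: integrable_second_moment_integrand)
  finally show ?thesis .
qed

lemma sum_UNIV_eq_single: "(\<And>p. p \<noteq> a \<Longrightarrow> g p = 0) \<Longrightarrow> (\<Sum>p\<in>(UNIV::'a::finite set). g p) = g a"
  by (subst sum.remove[of _ a]) (auto intro!: sum.neutral)

lemma sum4_UNIV_eq_single:
  fixes F :: "'a::finite \<Rightarrow> 'a \<Rightarrow> 'a \<Rightarrow> 'a \<Rightarrow> 'b::comm_monoid_add"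
  assumes "\<And>p q r s. \<not> (p = pa \<and> q = qa \<and> r = ra \<and> s = sa) \<Longrightarrow> F p q r s = 0"
  shows "(\<Sum>p\<in>UNIV. \<Sum>q\<in>UNIV. \<Sum>r\<in>UNIV. \<Sum>s\<in>UNIV. F p q r s) = F pa qa ra sa"
  using assms by (intro trans[OF sum_UNIV_eq_single] sum_UNIV_eq_single; auto intro!: sum.neutral)+

lemma sum_UNIV_restrict:
  "(\<And>p. p \<notin> S \<Longrightarrow> g p = 0) \<Longrightarrow> (\<Sum>p\<in>(UNIV::'a::finite set). g p) = (\<Sum>p\<in>S. g p)"
  by (rule sum.mono_neutral_right) auto

lemma sum4_UNIV_restrict:
  fixes F :: "'a::finite \<Rightarrow> 'a \<Rightarrow> 'a \<Rightarrow> 'a \<Rightarrow> 'b::comm_monoid_add"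
  assumes "\<And>p q r s. \<not> (p \<in> S \<and> q \<in> S \<and> r \<in> S \<and> s \<in> S) \<Longrightarrow> F p q r s = 0"
  shows "(\<Sum>p\<in>UNIV. \<Sum>q\<in>UNIV. \<Sum>r\<in>UNIV. \<Sum>s\<in>UNIV. F p q r s)
           = (\<Sum>p\<in>S. \<Sum>q\<in>S. \<Sum>r\<in>S. \<Sum>s\<in>S. F p q r s)"
  using assms
  by (intro trans[OF sum_UNIV_restrict] sum.cong refl sum_UNIV_restrict; auto intro!: sum.neutral)+

definition perm_mat :: "('d \<Rightarrow> 'd) \<Rightarrow> complex^'d::finite^'d" where
  "perm_mat \<sigma> = (\<chi> i j. if i = \<sigma> j then 1 else 0)"

lemma unitary_perm_mat:
  assumes "bij \<sigma>" shows "unitary_mat (perm_mat \<sigma>)"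
proof -
  have "(cadj (perm_mat \<sigma>) ** perm_mat \<sigma>) $ j $ k
          = (\<Sum>i\<in>UNIV. if i = \<sigma> j then (if \<sigma> j = \<sigma> k then 1 else 0) else 0)" for j k
    unfolding matrix_matrix_mult_def vec_lambda_beta by (intro sum.cong refl) (auto simp: perm_mat_def)
  thus ?thesis
    using bij_is_inj[OF assms] by (simp add: unitary_mat_iff_left vec_eq_iff mat_def inj_eq)
qed

lemma second_moment_perm:
  "bij \<sigma> \<Longrightarrow> second_moment X a b c e = second_moment X (\<sigma> a) (\<sigma> b) (\<sigma> c) (\<sigma> e)"
  by (subst second_moment_right_mult[OF unitary_perm_mat], assumption,
      subst sum4_UNIV_eq_single[where pa="\<sigma> a" and qa="\<sigma> b" and ra="\<sigma> c" and sa="\<sigma> e"])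
     (auto simp: perm_mat_def)

definition phase_mat :: "'d \<Rightarrow> complex^'d::finite^'d" where
  "phase_mat t = (\<chi> i j. if i = j then (if i = t then \<i> else 1) else 0)"

lemma unitary_phase_mat: "unitary_mat (phase_mat t)"
proof -
  have "(cadj (phase_mat t) ** phase_mat t) $ j $ k = (\<Sum>i\<in>UNIV. if i = j then
          (if i = k then cnj (if i = t then \<i> else 1) * (if i = t then \<i> else 1) else 0) else 0)" for j k
    unfolding matrix_matrix_mult_def vec_lambda_beta by (intro sum.cong refl) (auto simp: phase_mat_def)
  thus ?thesis by (simp add: unitary_mat_iff_left vec_eq_iff mat_def)
qed

lemma second_moment_phase:
  "second_moment X a b c e = cnj (if a = t then \<i> else 1) * (if b = t then \<i> else 1)
      * (if c = t then \<i> else 1) * cnj (if e = t then \<i> else 1) * second_moment X a b c e"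
  by (subst second_moment_right_mult[OF unitary_phase_mat[of t]],
      subst sum4_UNIV_eq_single[where pa=a and qa=b and ra=c and sa=e])
     (auto simp: phase_mat_def)

text \<open>The phases \<open>phase_mat t\<close> kill every entry whose indices are not paired up.\<close>

lemma second_moment_eq_0:
  assumes "\<not> ((a = b \<and> c = e) \<or> (a = c \<and> b = e))"
  shows "second_moment X a b c e = 0"
proof -
  have zero: "second_moment X a b c e = 0" if "second_moment X a b c e = f * second_moment X a b c e" "f \<noteq> 1" for f
    using that by (metis mult_cancel_right2)
  show ?thesis
  proof (cases "b = a \<or> b = e")
    case False
    show ?thesis by (rule zero[OF second_moment_phase[of X a b c e b]]) (use False in \<open>cases "c = b"; auto\<close>)
  next
    case True
    show ?thesis
      by (rule zero[OF second_moment_phase[of X a b c e c]])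
         (use True assms in \<open>cases "a = c"; cases "e = c"; auto\<close>)
  qed
qed

definition inv_sqrt2 :: complex where
  "inv_sqrt2 = of_real (1 / sqrt 2)"

lemma inv_sqrt2_squared: "inv_sqrt2 * inv_sqrt2 = 1 / 2"
  by (simp add: inv_sqrt2_def flip: of_real_mult)

lemma cnj_inv_sqrt2 [simp]: "cnj inv_sqrt2 = inv_sqrt2"
  by (simp add: inv_sqrt2_def)

definition rot_mat :: "'d \<Rightarrow> 'd \<Rightarrow> complex^'d::finite^'d" where
  "rot_mat x y = (\<chi> i j.
     if j = x then (if i = x \<or> i = y then inv_sqrt2 else 0)
     else if j = y then (if i = x then - inv_sqrt2 else if i = y then inv_sqrt2 else 0)
     else (if i = j then 1 else 0))"

lemma unitary_rot_mat:
  assumes xy: "x \<noteq> y" shows "unitary_mat (rot_mat x y)"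
proof -
  let ?R = "rot_mat x y"
  have entry: "(cadj ?R ** ?R) $ j $ k = (\<Sum>i\<in>UNIV. cnj (?R$i$j) * ?R$i$k)" for j k
    by (simp add: matrix_matrix_mult_def)
  have "(cadj ?R ** ?R) $ j $ k = (if j = k then 1 else 0)" for j k
  proof (cases "j \<in> {x, y} \<and> k \<in> {x, y}")
    case True
    have "(cadj ?R ** ?R) $ j $ k = (\<Sum>i\<in>{x, y}. cnj (?R$i$j) * ?R$i$k)"
      unfolding entry using True by (intro sum_UNIV_restrict) (auto simp: rot_mat_def)
    also have "\<dots> = (if j = k then 1 else 0)"
      using True xy by (auto simp: rot_mat_def inv_sqrt2_squared)
    finally show ?thesis .
  next
    case False
    hence "j \<notin> {x, y} \<or> k \<notin> {x, y}" by blast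
    thus ?thesis
    proof
      assume j: "j \<notin> {x, y}"
      have "(cadj ?R ** ?R) $ j $ k = (\<Sum>i\<in>UNIV. if i = j then ?R$j$k else 0)"
        unfolding entry using j by (intro sum.cong refl) (auto simp: rot_mat_def)
      thus ?thesis using j by (simp add: rot_mat_def)
    next
      assume k: "k \<notin> {x, y}"
      have "(cadj ?R ** ?R) $ j $ k = (\<Sum>i\<in>UNIV. if i = k then cnj (?R$k$j) else 0)"
        unfolding entry using k by (intro sum.cong refl) (auto simp: rot_mat_def)
      thus ?thesis using k by (auto simp: rot_mat_def)
    qed
  qed
  thus ?thesis by (simp add: unitary_mat_iff_left vec_eq_iff mat_def)
qed

lemma second_moment_rot:
  assumes xy: "x \<noteq> y"
  shows "second_moment X x x x x = second_moment X x x y y + second_moment X x y x y"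
proof -
  let ?R = "rot_mat x y"
  let ?K = "second_moment X"
  have swap: "?K y y y y = ?K x x x x" "?K y y x x = ?K x x y y" "?K y x y x = ?K x y x y"
    using second_moment_perm[OF bij_transpose, of X x x x x x y]
      second_moment_perm[OF bij_transpose, of X x x y y x y]
      second_moment_perm[OF bij_transpose, of X x y x y x y]
    by simp_all
  have "?K x x x x = (\<Sum>p\<in>{x,y}. \<Sum>q\<in>{x,y}. \<Sum>r\<in>{x,y}. \<Sum>s\<in>{x,y}.
            (cnj (?R$p$x) * ?R$q$x * ?R$r$x * cnj (?R$s$x)) * ?K p q r s)"
    unfolding second_moment_right_mult[OF unitary_rot_mat[OF xy], of X x x x x]
    by (rule sum4_UNIV_restrict) (auto simp: rot_mat_def)
  also have "\<dots> = (1/2) * (1/2) * (2 * ?K x x x x + 2 * ?K x x y y + 2 * ?K x y x y)"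
    using xy
    by (simp add: rot_mat_def second_moment_eq_0 swap algebra_simps inv_sqrt2_squared[symmetric])
  also have "\<dots> = (?K x x x x + ?K x x y y + ?K x y x y) / 2"
    by (simp add: field_simps)
  finally show ?thesis by (simp add: field_simps)
qed

lemma ex_bij_map_pair:
  fixes x y a c :: 'a
  assumes "x \<noteq> y" "a \<noteq> c"
  shows "\<exists>\<sigma>. bij \<sigma> \<and> \<sigma> x = a \<and> \<sigma> y = c"
proof -
  let ?\<tau> = "Transposition.transpose x a"
  let ?\<sigma> = "Transposition.transpose (?\<tau> y) c \<circ> ?\<tau>"
  have "?\<tau> y \<noteq> a" using assms by (auto simp: Transposition.transpose_def)
  hence "?\<sigma> x = a" "?\<sigma> y = c" using assms by (auto simp: Transposition.transpose_def)
  moreover have "bij ?\<sigma>" by (intro bij_comp bij_transpose)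
  ultimately show ?thesis by blast
qed

lemma second_moment_shape:
  assumes xy: "x \<noteq> y"
  shows "second_moment X a b c e = (if a = b \<and> c = e then second_moment X x x y y else 0)
                                  + (if a = c \<and> b = e then second_moment X x y x y else 0)"
proof (cases "(a = b \<and> c = e) \<or> (a = c \<and> b = e)")
  case False then show ?thesis using second_moment_eq_0[OF False] by auto
next
  case paired: True
  consider "a = b" "b = c" "c = e" | "a = b" "c = e" "a \<noteq> c" | "a = c" "b = e" "a \<noteq> b"
    using paired by blast
  then show ?thesis
  proof cases
    case 1
    have "second_moment X a a a a = second_moment X x x x x"
      using second_moment_perm[OF bij_transpose, of X x x x x x a] by simp
    then show ?thesis using 1 second_moment_rot[OF xy] by simp
  next
    case 2
    obtain \<sigma> where "bij \<sigma>" "\<sigma> x = a" "\<sigma> y = c" using ex_bij_map_pair[OF xy \<open>a \<noteq> c\<close>] by blast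
    then show ?thesis using 2 second_moment_perm[of \<sigma> X x x y y] by simp
  next
    case 3
    obtain \<sigma> where "bij \<sigma>" "\<sigma> x = a" "\<sigma> y = b" using ex_bij_map_pair[OF xy \<open>a \<noteq> b\<close>] by blast
    then show ?thesis using 3 second_moment_perm[of \<sigma> X x y x y] by simp
  qed
qed

lemma trace_adj_conj: "unitary_mat U \<Longrightarrow> trace (adj_conj X U) = trace X"
  unfolding adj_conj_def by (metis trace_mul_sym matrix_mul_assoc matrix_mul_lid unitary_mat_def)

lemma adj_conj_mult_cadj:
  "unitary_mat U \<Longrightarrow> adj_conj X U ** cadj (adj_conj X U) = adj_conj (X ** cadj X) U"
  unfolding adj_conj_def cadj_mult cadj_cadj unitary_mat_def
  by (metis (no_types, lifting) matrix_mul_assoc matrix_mul_lid)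

lemma sum_second_moment_diag:
  fixes X :: "complex^'d::finite^'d"
  assumes "trace X = 0" shows "(\<Sum>a\<in>UNIV. second_moment X a a c c) = 0"
proof -
  have "(\<Sum>a\<in>UNIV. second_moment X a a c c)
      = (\<integral>U. trace (adj_conj X U) * cnj (adj_conj X U $ c $ c) \<partial>haar)"
    unfolding second_moment_def trace_def sum_distrib_right
    by (simp add: integrable_second_moment_integrand)
  also have "\<dots> = (\<integral>U. 0 \<partial>(haar :: (complex^'d^'d) measure))"
  proof (rule integral_cong_AE)
    show "AE U in haar. trace (adj_conj X U) * cnj (adj_conj X U $ c $ c) = 0"
      using AE_haar_unitary by eventually_elim (simp add: trace_adj_conj assms)
  qed (unfold trace_def, measurable)
  finally show ?thesis by simp
qed

lemma sum_second_moment_pairs: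
  fixes X :: "complex^'d::finite^'d"
  shows "(\<Sum>a\<in>UNIV. \<Sum>b\<in>UNIV. second_moment X a b a b) = trace (X ** cadj X)"
proof -
  have "(\<Sum>a\<in>UNIV. \<Sum>b\<in>UNIV. second_moment X a b a b)
      = (\<integral>U. trace (adj_conj X U ** cadj (adj_conj X U)) \<partial>haar)"
    unfolding second_moment_def
    by (simp add: integrable_second_moment_integrand trace_def matrix_matrix_mult_def)
  also have "\<dots> = (\<integral>U. trace (X ** cadj X) \<partial>(haar :: (complex^'d^'d) measure))"
  proof (rule integral_cong_AE)
    show "AE U in haar. trace (adj_conj X U ** cadj (adj_conj X U)) = trace (X ** cadj X)"
      using AE_haar_unitary by eventually_elim (simp add: adj_conj_mult_cadj trace_adj_conj)
  qed (unfold trace_def adj_conj_def, measurable)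
  finally show ?thesis by simp
qed

lemma second_moment_formula:
  fixes X :: "complex^'d::finite^'d"
  assumes d2: "CARD('d) \<ge> 2" and tr: "trace X = 0" and tr2: "trace (X ** cadj X) = of_nat CARD('d)"
  shows "second_moment X a b c e
           = (if a = b \<and> c = e then 1 / (1 - of_nat CARD('d)^2) else 0)
           + (if a = c \<and> b = e then - of_nat CARD('d) / (1 - of_nat CARD('d)^2) else 0)"
proof -
  let ?d = "of_nat CARD('d) :: complex"
  obtain x y :: 'd where xy: "x \<noteq> y"
    using d2 by (meson card_2_iff' ex_card)
  define \<alpha> where "\<alpha> = second_moment X x x y y"
  define \<beta> where "\<beta> = second_moment X x y x y"
  have shape: "second_moment X a b c e = (if a = b \<and> c = e then \<alpha> else 0) + (if a = c \<and> b = e then \<beta> else 0)"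
    for a b c e
    unfolding \<alpha>_def \<beta>_def by (rule second_moment_shape[OF xy])
  have "(\<Sum>a\<in>UNIV. second_moment X a a x x) = (\<Sum>a::'d\<in>UNIV. \<alpha> + (if a = x then \<beta> else 0))"
    by (intro sum.cong refl) (auto simp: shape)
  hence diag: "?d * \<alpha> + \<beta> = 0"
    using sum_second_moment_diag[OF tr, of x] by (simp add: sum.distrib)
  have "(\<Sum>a\<in>UNIV. \<Sum>b\<in>UNIV. second_moment X a b a b)
          = (\<Sum>a::'d\<in>UNIV. \<Sum>b::'d\<in>UNIV. (if a = b then \<alpha> else 0) + \<beta>)"
    by (intro sum.cong refl) (auto simp: shape)
  hence pairs: "?d * \<alpha> + ?d * ?d * \<beta> = ?d"
    using sum_second_moment_pairs[of X] tr2 by (simp add: sum.distrib algebra_simps)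
  have beta: "\<beta> = - ?d * \<alpha>"
    using diag by (simp add: algebra_simps add_eq_0_iff2)
  have "?d \<noteq> 0" "1 - ?d^2 \<noteq> 0"
    using d2 by (auto simp: power2_eq_square simp flip: of_nat_mult)
  moreover have "?d * (\<alpha> * (1 - ?d^2)) = ?d * 1"
    using pairs by (simp add: beta power2_eq_square algebra_simps)
  ultimately have alpha: "\<alpha> = 1 / (1 - ?d^2)"
    by (simp add: eq_divide_eq)
  have "\<beta> = - ?d / (1 - ?d^2)"
    by (simp add: beta alpha)
  with alpha show ?thesis by (simp add: shape)
qed

section \<open>The theorem\<close>

lemma cmod_trace_mult_tensor_prod_squared:
  fixes \<rho> :: "complex^('n::finite \<Rightarrow> 'd::finite)^('n \<Rightarrow> 'd)"
  shows "(cmod (trace (\<rho> ** tensor_prod A)))\<^sup>2 =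
    Re (\<Sum>i\<in>UNIV. \<Sum>j\<in>UNIV. \<Sum>k\<in>UNIV. \<Sum>l\<in>UNIV. \<rho>$i$j * cnj (\<rho>$k$l) *
        (\<Prod>n\<in>UNIV. A n $ (j n) $ (i n) * cnj (A n $ (l n) $ (k n))))"
proof -
  let ?z = "trace (\<rho> ** tensor_prod A)"
  have z: "?z = (\<Sum>i\<in>UNIV. \<Sum>j\<in>UNIV. \<rho>$i$j * (\<Prod>n\<in>UNIV. A n $ (j n) $ (i n)))"
    by (simp add: trace_def matrix_matrix_mult_def tensor_prod_def)
  have "(cmod ?z)\<^sup>2 = Re (?z * cnj ?z)"
    by (metis Re_complex_of_real complex_norm_square)
  also have "?z * cnj ?z = (\<Sum>i\<in>UNIV. \<Sum>j\<in>UNIV. \<Sum>k\<in>UNIV. \<Sum>l\<in>UNIV. \<rho>$i$j * cnj (\<rho>$k$l) *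
        (\<Prod>n\<in>UNIV. A n $ (j n) $ (i n) * cnj (A n $ (l n) $ (k n))))"
    unfolding z cnj_sum sum_product_sum
    by (intro sum.cong refl) (simp add: prod.distrib cnj_prod mult_ac)
  finally show ?thesis .
qed

lemma R_fun_eq_sum_second_moments:
  fixes \<rho> :: "complex^('n::finite \<Rightarrow> 'd::finite)^('n \<Rightarrow> 'd)"
  shows "R_fun \<rho> lam = Re (\<Sum>i\<in>UNIV. \<Sum>j\<in>UNIV. \<Sum>k\<in>UNIV. \<Sum>l\<in>UNIV. \<rho>$i$j * cnj (\<rho>$k$l) *
        (\<Prod>n\<in>UNIV. second_moment (cadj (lam n)) (j n) (i n) (l n) (k n)))"
proof -
  interpret product_prob_space "\<lambda>_::'n. haar :: (complex^'d^'d) measure" UNIV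
    by unfold_locales
  let ?M = "PiM UNIV (\<lambda>_::'n. haar :: (complex^'d^'d) measure)"
  let ?g = "\<lambda>i j k l (Us::'n \<Rightarrow> complex^'d^'d). \<Prod>n\<in>UNIV.
      adj_conj (cadj (lam n)) (Us n) $ (j n) $ (i n) * cnj (adj_conj (cadj (lam n)) (Us n) $ (l n) $ (k n))"
  have integrable_g: "integrable ?M (?g i j k l)" for i j k l
    by (rule product_integrable_prod) (simp_all add: integrable_second_moment_integrand)
  have integral_g: "(\<integral>Us. ?g i j k l Us \<partial>?M) = (\<Prod>n\<in>UNIV. second_moment (cadj (lam n)) (j n) (i n) (l n) (k n))"
    for i j k l
    unfolding second_moment_def
    by (rule product_integral_prod) (simp_all add: integrable_second_moment_integrand)
  have "R_fun \<rho> lam = (\<integral>Us. Re (\<Sum>i\<in>UNIV. \<Sum>j\<in>UNIV. \<Sum>k\<in>UNIV. \<Sum>l\<in>UNIV.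
                           \<rho>$i$j * cnj (\<rho>$k$l) * ?g i j k l Us) \<partial>?M)"
    unfolding R_fun_def by (simp add: cmod_trace_mult_tensor_prod_squared adj_conj_def)
  also have "\<dots> = Re (\<Sum>i\<in>UNIV. \<Sum>j\<in>UNIV. \<Sum>k\<in>UNIV. \<Sum>l\<in>UNIV.
                       \<rho>$i$j * cnj (\<rho>$k$l) * (\<integral>Us. ?g i j k l Us \<partial>?M))"
    by (subst integral_Re)
       (simp_all add: integrable_g integral_sum integrable_sum del: integral_mult_right_zero)
  finally show ?thesis unfolding integral_g .
qed

theorem theorem9:
  fixes \<rho> :: "complex^('n::finite \<Rightarrow> 'd::finite)^('n \<Rightarrow> 'd)"
  assumes "CARD('d) \<ge> 2"
    and "is_state \<rho>"
    and "\<forall>n. trace (lam n) = 0 \<and> trace (lam n ** cadj (lam n)) = of_nat CARD('d)"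
    and "\<forall>n. trace (mu n) = 0 \<and> trace (mu n ** cadj (mu n)) = of_nat CARD('d)"
  shows "R_fun \<rho> lam = R_fun \<rho> mu"
proof -
  have adjoint_normalized: "trace (cadj L) = 0 \<and> trace (cadj L ** cadj (cadj L)) = of_nat CARD('d)"
    if "trace L = 0 \<and> trace (L ** cadj L) = of_nat CARD('d)" for L :: "complex^'d^'d"
    using that by (simp add: trace_cadj trace_mul_sym[of "cadj L"])
  have "second_moment (cadj (lam n)) = second_moment (cadj (mu n))" for n
    using adjoint_normalized[of "lam n"] adjoint_normalized[of "mu n"] assms(1,3,4)
    by (simp add: fun_eq_iff second_moment_formula)
  thus ?thesis by (simp add: R_fun_eq_sum_second_moments)
qed

end
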